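(* Let $G=(S\cup K,E)$ be a split graph without isolated vertices, where $S$ is an independent set and $K$ is a clique of $G$, and assume $K$ is a maximum clique, i.e. $\omega(G)=|K|$. Then $Tr_t(G)=1$ if and only if $G$ satisfies one of the following conditions: (a) $\deg(s)=1$ for all $s\in S$, and at most one vertex of $K$ has no neighbour in $S$; (b) for every $s\in S$ with $\deg(s)\geq 2$, each vertex of $N(s)$ is a support vertex, and at most one vertex of $K$ has no neighbour in $S$.
   Context: All graphs are finite, simple, and have no isolated vertices. For a graph $G=(V,E)$, a total transitive partition of order $k$ is a partition $\pi=\{V_1,\dots,V_k\}$ of $V$ into nonempty sets such that for all $1\leq i\leq j\leq k$, every vertex of $V_j$ has a neighbour in $V_i$ (for $i=j$ this means every vertex of $V_i$ is adjacent to another vertex of $V_i$). Equivalently, $V_1$ is a total dominating set of $G$ and each $V_{i+1}$ is a total dominating set of $G-\bigcup_{j\le i}V_j$. The total transitivity $Tr_t(G)$ is the maximum order of a total transitive partition of $G$. A leaf is a vertex of degree $1$; a support vertex is a vertex adjacent to a leaf. $N(v)$ denotes the open neighbourhood of $v$.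
   Formalization: The case of empty S is restricted to |K| ≥ 4: with S empty, the graphs K_2 and K_3 have Tr_t = 1 although (a) and (b) both fail, and the empty graph satisfies (a) without Tr_t = 1; all other cases are covered. *)

theory Defs
  imports "HOL-Library.Ramsey" "HOL-Library.Disjoint_Sets"
begin

definition simple_graph :: "'a set \<Rightarrow> 'a set set \<Rightarrow> bool" where
  "simple_graph V E \<longleftrightarrow> finite V \<and> E \<subseteq> [V]\<^bsup>2\<^esup>"

definition nbhd :: "'a set set \<Rightarrow> 'a \<Rightarrow> 'a set" where
  "nbhd E v = {u. {u, v} \<in> E}"

definition deg :: "'a set set \<Rightarrow> 'a \<Rightarrow> nat" where
  "deg E v = card (nbhd E v)"

definition no_isolated :: "'a set \<Rightarrow> 'a set set \<Rightarrow> bool" where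
  "no_isolated V E \<longleftrightarrow> (\<forall>v\<in>V. nbhd E v \<noteq> {})"

definition leaf :: "'a set set \<Rightarrow> 'a \<Rightarrow> bool" where
  "leaf E v \<longleftrightarrow> deg E v = 1"

definition support_vertex :: "'a set set \<Rightarrow> 'a \<Rightarrow> bool" where
  "support_vertex E v \<longleftrightarrow> (\<exists>u\<in>nbhd E v. leaf E u)"

definition clique_number :: "'a set \<Rightarrow> 'a set set \<Rightarrow> nat" where
  "clique_number V E = Max {card C | C. C \<subseteq> V \<and> clique C E}"

definition split_partition :: "'a set \<Rightarrow> 'a set set \<Rightarrow> 'a set \<Rightarrow> 'a set \<Rightarrow> bool" where
  "split_partition V E S K \<longleftrightarrow> V = S \<union> K \<and> S \<inter> K = {} \<and> indep S E \<and> clique K E"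

definition total_transitive_partition ::
    "'a set \<Rightarrow> 'a set set \<Rightarrow> nat \<Rightarrow> (nat \<Rightarrow> 'a set) \<Rightarrow> bool" where
  "total_transitive_partition V E k P \<longleftrightarrow>
     (\<Union>i\<in>{1..k}. P i) = V \<and> disjoint_family_on P {1..k} \<and> (\<forall>i\<in>{1..k}. P i \<noteq> {}) \<and>
     (\<forall>i j. 1 \<le> i \<and> i \<le> j \<and> j \<le> k \<longrightarrow> (\<forall>v\<in>P j. nbhd E v \<inter> P i \<noteq> {}))"

text \<open>
  For finite \<open>V\<close> the orders are bounded by \<open>card V\<close>, and if \<open>V\<close> is moreover nonempty and has no
  isolated vertex, then \<open>{V}\<close> is a total transitive partition of order 1; so this is the maximum of
  a finite nonempty set.
\<close>

definition total_transitivity :: "'a set \<Rightarrow> 'a set set \<Rightarrow> nat" where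
  "total_transitivity V E = Max {k. \<exists>P. total_transitive_partition V E k P}"

end

theory Submission
  imports Defs
begin

text \<open>
  A leaf and its support vertex always lie in the first class. Under (b), every vertex of \<open>K\<close> with a
  neighbour in \<open>S\<close> is a support vertex, so all of \<open>S\<close> and all but at most one vertex of \<open>K\<close> lie in
  the first class; but a second class would contain two adjacent vertices. Conversely, if (b) fails,
  there is an edge \<open>ab\<close> such that every vertex has a neighbour outside \<open>{a, b}\<close>, and
  \<open>{V - {a, b}, {a, b}}\<close> is a total transitive partition: take for \<open>a, b\<close> either two vertices of
  \<open>K\<close> without neighbours in \<open>S\<close>, or some \<open>s \<in> S\<close> of degree at least 2 together with a neighbour
  that is not a support vertex. Condition (a) is a special case of (b).
\<close>

section \<open>Neighbourhoods, cliques and split partitions\<close>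

lemma nbhd_sym: "u \<in> nbhd E v \<longleftrightarrow> v \<in> nbhd E u"
  by (simp add: nbhd_def insert_commute)

lemma simple_graph_nbhd:
  assumes "simple_graph V E" "u \<in> nbhd E v"
  shows "u \<in> V" "v \<in> V" "u \<noteq> v"
proof -
  have "{u, v} \<in> [V]\<^bsup>2\<^esup>" using assms unfolding simple_graph_def nbhd_def by blast
  then show "u \<in> V" "v \<in> V" "u \<noteq> v" by auto
qed

lemma finite_nbhd:
  assumes "simple_graph V E"
  shows "finite (nbhd E v)"
proof (rule finite_subset)
  show "nbhd E v \<subseteq> V" using simple_graph_nbhd[OF assms] by blast
  show "finite V" using assms by (simp add: simple_graph_def)
qed

lemma obtain_two_elements:
  assumes "2 \<le> card A"
  obtains a b where "a \<in> A" "b \<in> A" "a \<noteq> b"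
proof -
  have "finite A" using assms by (auto intro: card_ge_0_finite)
  then show thesis using that assms card_le_Suc0_iff_eq[of A] by fastforce
qed

lemma nbhd_split_subset:
  assumes "simple_graph V E" "split_partition V E S K" "s \<in> S"
  shows "nbhd E s \<subseteq> K"
proof
  fix u assume u: "u \<in> nbhd E s"
  then have "u \<notin> S"
    using simple_graph_nbhd(3)[OF assms(1) u] assms(2,3)
    unfolding split_partition_def indep_def nbhd_def by blast
  then show "u \<in> K"
    using simple_graph_nbhd(1)[OF assms(1) u] assms(2) unfolding split_partition_def by blast
qed

lemma clique_nbhd:
  assumes "clique K E" "u \<in> K" "v \<in> K" "u \<noteq> v"
  shows "u \<in> nbhd E v"
  using assms by (simp add: clique_def nbhd_def)

lemma card_clique_le_clique_number:
  assumes "finite V" "C \<subseteq> V" "clique C E"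
  shows "card C \<le> clique_number V E"
  unfolding clique_number_def
proof (rule Max_ge)
  have "{card C | C. C \<subseteq> V \<and> clique C E} \<subseteq> card ` Pow V" by blast
  then show "finite {card C | C. C \<subseteq> V \<and> clique C E}"
    using assms(1) by (meson finite_Pow_iff finite_imageI finite_subset)
qed (use assms in blast)

section \<open>Total transitive partitions in arbitrary graphs\<close>

text \<open>Disjoint nonempty classes contribute at least one vertex each. The bound makes the set
  of orders finite, so that its \<open>Max\<close> is meaningful.\<close>

lemma total_transitive_partition_order_le:
  assumes "finite V" "total_transitive_partition V E k P"
  shows "k \<le> card V"
proof -
  have V: "(\<Union>i\<in>{1..k}. P i) = V" and disj: "disjoint_family_on P {1..k}"
    and ne: "\<And>i. i \<in> {1..k} \<Longrightarrow> P i \<noteq> {}"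
    using assms(2) by (auto simp: total_transitive_partition_def)
  have fin: "finite (P i)" if "i \<in> {1..k}" for i
    using that V assms(1) by (metis UN_upper finite_subset)
  have "k = (\<Sum>i\<in>{1..k}. 1)" by simp
  also have "\<dots> \<le> (\<Sum>i\<in>{1..k}. card (P i))"
    using ne fin by (intro sum_mono) (simp add: Suc_leI card_gt_0_iff)
  also have "\<dots> = card (\<Union>i\<in>{1..k}. P i)"
    using fin disj by (intro card_UN_disjoint[symmetric]) (auto simp: disjoint_family_on_def)
  finally show ?thesis using V by simp
qed

lemma total_transitive_partition_trivial:
  assumes "simple_graph V E" "no_isolated V E" "V \<noteq> {}"
  shows "total_transitive_partition V E 1 (\<lambda>_. V)"
proof -
  have "nbhd E v \<inter> V \<noteq> {}" if "v \<in> V" for v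
    using that assms(2) simple_graph_nbhd(1)[OF assms(1)] unfolding no_isolated_def by blast
  then show ?thesis
    using assms(3) by (auto simp: total_transitive_partition_def disjoint_family_on_def)
qed

lemma total_transitivity_eq_1_iff:
  assumes "simple_graph V E" "no_isolated V E" "V \<noteq> {}"
  shows "total_transitivity V E = 1 \<longleftrightarrow>
    (\<forall>k P. total_transitive_partition V E k P \<longrightarrow> k \<le> 1)"
proof -
  let ?M = "{k. \<exists>P. total_transitive_partition V E k P}"
  have "?M \<subseteq> {..card V}"
    using assms(1) total_transitive_partition_order_le by (auto simp: simple_graph_def)
  then have "finite ?M" by (rule finite_subset) simp
  moreover have "1 \<in> ?M"
    using total_transitive_partition_trivial[OF assms] by blast
  ultimately have "Max ?M = 1 \<longleftrightarrow> (\<forall>k\<in>?M. k \<le> 1)"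
    by (subst Max_eq_iff) auto
  then show ?thesis unfolding total_transitivity_def by auto
qed

text \<open>By \<open>out\<close>, the complement of the edge contains a neighbour of every vertex,
  which settles \<open>i = 1\<close> for both classes; within the second class \<open>a\<close> and
  \<open>b\<close> serve each other.\<close>

lemma total_transitive_partition_of_edge:
  assumes "simple_graph V E" "{a, b} \<in> E"
    and out: "\<And>v. v \<in> V \<Longrightarrow> \<not> nbhd E v \<subseteq> {a, b}"
  shows "total_transitive_partition V E 2 (\<lambda>i. if i = 1 then V - {a, b} else {a, b})"
proof -
  let ?P = "\<lambda>i::nat. if i = 1 then V - {a, b} else {a, b}"
  have ab: "a \<in> nbhd E b" "b \<in> nbhd E a"
    using assms(2) by (simp_all add: nbhd_def insert_commute)
  then have V: "a \<in> V" "b \<in> V" using simple_graph_nbhd[OF assms(1)] by blast+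
  have dom: "nbhd E v \<inter> (V - {a, b}) \<noteq> {}" if "v \<in> V" for v
    using out[OF that] simple_graph_nbhd(1)[OF assms(1)] by blast
  have I: "{1..2::nat} = {1, 2}" by auto
  have "nbhd E v \<inter> ?P i \<noteq> {}" if ij: "1 \<le> i" "i \<le> j" "j \<le> 2" and v: "v \<in> ?P j" for i j v
  proof (cases "i = 1")
    case True
    with v V dom show ?thesis by (auto split: if_splits)
  next
    case False
    with ij v have "v = a \<or> v = b" by auto
    with False ab show ?thesis by auto
  qed
  then have "\<forall>i j. 1 \<le> i \<and> i \<le> j \<and> j \<le> 2 \<longrightarrow> (\<forall>v\<in>?P j. nbhd E v \<inter> ?P i \<noteq> {})"
    by blast
  \<comment> \<open>The first class is nonempty because \<open>a\<close> has a neighbour in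
    it.\<close>
  moreover have "(\<Union>i\<in>{1..2}. ?P i) = V" "disjoint_family_on ?P {1..2}" "\<forall>i\<in>{1..2}. ?P i \<noteq> {}"
    using V dom[OF V(1)] unfolding I by (auto simp: disjoint_family_on_def)
  ultimately show ?thesis unfolding total_transitive_partition_def by blast
qed

text \<open>A leaf at \<open>v\<close>, whatever its class, needs a neighbour in \<open>P 1\<close>,
  and \<open>v\<close> is its only neighbour.\<close>

lemma support_vertex_in_first_class:
  assumes "simple_graph V E" "total_transitive_partition V E k P" "support_vertex E v"
  shows "v \<in> P 1"
proof -
  obtain u where u: "u \<in> nbhd E v" "card (nbhd E u) = 1"
    using assms(3) by (auto simp: support_vertex_def leaf_def deg_def)
  then have Nu: "nbhd E u = {v}"
    using nbhd_sym by (metis card_1_singletonE singletonD)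
  have "u \<in> V" using simple_graph_nbhd(1)[OF assms(1) u(1)] .
  then obtain j where j: "1 \<le> j" "j \<le> k" "u \<in> P j"
    using assms(2) unfolding total_transitive_partition_def by fastforce
  then have "nbhd E u \<inter> P 1 \<noteq> {}"
    using assms(2) unfolding total_transitive_partition_def by blast
  with Nu show ?thesis by simp
qed

section \<open>Split graphs satisfying (b)\<close>

lemma split_order_le_1:
  assumes sg: "simple_graph V E" and sp: "split_partition V E S K"
    and supp: "\<And>s v. s \<in> S \<Longrightarrow> 2 \<le> deg E s \<Longrightarrow> v \<in> nbhd E s \<Longrightarrow> support_vertex E v"
    and few: "card {v\<in>K. nbhd E v \<inter> S = {}} \<le> 1"
    and part: "total_transitive_partition V E k P"
  shows "k \<le> 1"
proof (rule ccontr)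
  assume "\<not> k \<le> 1"
  then have k: "2 \<le> k" by simp
  then have I: "1 \<in> {1..k}" "2 \<in> {1..k}" by auto
  have disj: "P 1 \<inter> P 2 = {}"
  proof (rule disjoint_family_onD[OF _ I])
    show "disjoint_family_on P {1..k}"
      using part unfolding total_transitive_partition_def by blast
  qed simp
  have ne: "P 2 \<noteq> {}" and sub: "P 2 \<subseteq> V"
    using part I(2) unfolding total_transitive_partition_def by blast+
  \<comment> \<open>This is the case \<open>i = j = 2\<close> of the definition: it forces
    \<open>P 2\<close> to contain two adjacent vertices.\<close>
  have dom: "nbhd E v \<inter> P 2 \<noteq> {}" if "v \<in> P 2" for v
    using part k that unfolding total_transitive_partition_def
    by (metis one_le_numeral order_refl)
  have N: "nbhd E s \<subseteq> P 1" if s: "s \<in> S" for s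
  proof
    fix v assume v: "v \<in> nbhd E s"
    \<comment> \<open>Either \<open>supp\<close> applies, or \<open>s\<close> has degree 1 and is
      itself a leaf adjacent to \<open>v\<close>.\<close>
    have "support_vertex E v"
    proof (cases "2 \<le> deg E s")
      case False
      moreover have "deg E s \<noteq> 0"
        using v finite_nbhd[OF sg] by (auto simp: deg_def)
      ultimately have "leaf E s" by (simp add: leaf_def)
      with v show ?thesis using nbhd_sym[of v E s] unfolding support_vertex_def by blast
    qed (use supp s v in blast)
    then show "v \<in> P 1" by (rule support_vertex_in_first_class[OF sg part])
  qed
  \<comment> \<open>A vertex of \<open>S\<close> has all its neighbours in \<open>P 1\<close>, hence
    none in \<open>P 2\<close>; a vertex with a neighbour in \<open>S\<close> lies in
    \<open>P 1\<close> by \<open>N\<close>.\<close>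
  have in_A: "P 2 \<subseteq> {v\<in>K. nbhd E v \<inter> S = {}}"
  proof
    fix v assume v: "v \<in> P 2"
    have "v \<notin> S" using dom[OF v] N disj by blast
    then have "v \<in> K" using v sub sp by (auto simp: split_partition_def)
    moreover have "nbhd E v \<inter> S = {}" using v N disj nbhd_sym[of _ E v] by blast
    ultimately show "v \<in> {v\<in>K. nbhd E v \<inter> S = {}}" by blast
  qed
  obtain a b where ab: "a \<in> P 2" "b \<in> P 2" "b \<in> nbhd E a"
    using ne dom by blast
  then have "a \<noteq> b" using simple_graph_nbhd(3)[OF sg] by blast
  have "finite {v\<in>K. nbhd E v \<inter> S = {}}"
    using sg sp by (simp add: simple_graph_def split_partition_def)
  then have "card {a, b} \<le> 1"
    using ab in_A few by (meson card_mono empty_subsetI insert_subset order_trans subsetD)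
  with \<open>a \<noteq> b\<close> show False by simp
qed

section \<open>Partitions of order 2 when (b) fails\<close>

text \<open>The edge \<open>{a, b}\<close> can be split off as a second class. The hypothesis on
  \<open>S = {}\<close> excludes the complete graphs on two or three vertices: there several
  vertices of \<open>K\<close> have no neighbour in \<open>S\<close>, yet two classes of at least
  two vertices each do not fit.\<close>

lemma split_order_2_of_two_inner:
  assumes sg: "simple_graph V E" and ni: "no_isolated V E" and sp: "split_partition V E S K"
    and S: "S = {} \<longrightarrow> 4 \<le> card K"
    and ab: "a \<in> K" "b \<in> K" "a \<noteq> b" "nbhd E a \<inter> S = {}" "nbhd E b \<inter> S = {}"
  shows "\<exists>P. total_transitive_partition V E 2 P"
proof -
  have V: "V = S \<union> K" and cl: "clique K E" and SK: "S \<inter> K = {}"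
    using sp by (auto simp: split_partition_def)
  have S_out: "\<exists>u\<in>K - {a, b}. u \<in> nbhd E s" if s: "s \<in> S" for s
  proof -
    obtain u where u: "u \<in> nbhd E s" using ni s V by (auto simp: no_isolated_def)
    then have "u \<noteq> a" "u \<noteq> b" using s ab(4,5) nbhd_sym[of u E s] by blast+
    then show ?thesis using u nbhd_split_subset[OF sg sp s] by blast
  qed
  have out: "\<not> nbhd E v \<subseteq> {a, b}" if v: "v \<in> V" for v
  proof (cases "v \<in> S \<or> nbhd E v \<inter> S \<noteq> {}")
    case True
    then show ?thesis using S_out ab(1,2) SK by blast
  next
    case False
    then have vK: "v \<in> K" and vS: "nbhd E v \<inter> S = {}" using v V by blast+
    \<comment> \<open>If \<open>S\<close> is empty, four vertices of \<open>K\<close> suffice to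
      avoid \<open>v\<close>, \<open>a\<close> and \<open>b\<close>. Otherwise a neighbour of some
      \<open>s\<close> in \<open>S\<close> works: it has a neighbour in \<open>S\<close>, while
      \<open>v\<close>, \<open>a\<close> and \<open>b\<close> have none.\<close>
    have "\<exists>u\<in>K. u \<noteq> v \<and> u \<notin> {a, b}"
    proof (cases "S = {}")
      case True
      have "card {v, a, b} \<le> 3" by (simp add: card_insert_if)
      then have "\<not> K \<subseteq> {v, a, b}"
        using True S card_mono[of "{v, a, b}" K] by auto
      then show ?thesis by blast
    next
      case False
      then obtain s where s: "s \<in> S" by blast
      then obtain u where "u \<in> K - {a, b}" "u \<in> nbhd E s" using S_out by blast
      moreover from this have "u \<noteq> v" using s vS nbhd_sym[of u E s] by blast
      ultimately show ?thesis by blast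
    qed
    then show ?thesis using clique_nbhd[OF cl] vK by blast
  qed
  have "{a, b} \<in> E" using cl ab by (simp add: clique_def)
  then show ?thesis using total_transitive_partition_of_edge[OF sg _ out] by blast
qed

text \<open>The edge \<open>{s, w}\<close> can be split off as a second class. That \<open>s\<close>
  has a second neighbour follows from \<open>w\<close> not being a support vertex.\<close>

lemma split_order_2_of_non_support:
  assumes sg: "simple_graph V E" and ni: "no_isolated V E" and sp: "split_partition V E S K"
    and om: "clique_number V E = card K"
    and s: "s \<in> S" and w: "w \<in> nbhd E s" "\<not> support_vertex E w"
  shows "\<exists>P. total_transitive_partition V E 2 P"
proof -
  have V: "V = S \<union> K" and cl: "clique K E" and SK: "S \<inter> K = {}" and fin: "finite V"
    using sp sg by (auto simp: split_partition_def simple_graph_def)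
  have wK: "w \<in> K" using nbhd_split_subset[OF sg sp s] w(1) by blast
  \<comment> \<open>If \<open>w\<close> were the only neighbour of \<open>t\<close>, then
    \<open>t\<close> would be a leaf and \<open>w\<close> a support vertex.\<close>
  have S_out: "\<exists>u\<in>K - {w}. u \<in> nbhd E t" if t: "t \<in> S" for t
  proof -
    have "nbhd E t \<noteq> {w}"
      using w(2) nbhd_sym[of w E t] by (auto simp: support_vertex_def leaf_def deg_def)
    moreover have "nbhd E t \<noteq> {}" using ni t V by (auto simp: no_isolated_def)
    ultimately show ?thesis using nbhd_split_subset[OF sg sp t] by blast
  qed
  \<comment> \<open>Otherwise \<open>K\<close> consists of two neighbours of \<open>s\<close>, and \<open>insert s K\<close> is a larger clique.\<close>
  have K_out: "\<exists>u\<in>K - {w}. u \<noteq> v" for v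
  proof (rule ccontr)
    assume "\<not> ?thesis"
    then have "K \<subseteq> {w, v}" by blast
    moreover obtain u where "u \<in> K - {w}" "u \<in> nbhd E s" using S_out[OF s] by blast
    ultimately have "K \<subseteq> nbhd E s" using w(1) by blast
    then have "clique (insert s K) E"
      using cl by (auto simp: clique_def nbhd_def insert_commute)
    then have "card (insert s K) \<le> card K"
      using card_clique_le_clique_number[OF fin, of "insert s K" E] om s V by auto
    moreover have "s \<notin> K" "finite K" using fin V SK s by auto
    ultimately show False by simp
  qed
  have out: "\<not> nbhd E v \<subseteq> {s, w}" if v: "v \<in> V" for v
  proof (cases "v \<in> S")
    case True
    then show ?thesis using S_out[OF True] s SK by blast
  next
    case False
    then have "v \<in> K" using v V by blast
    \<comment> \<open>The vertex from \<open>K_out\<close> is adjacent to \<open>v\<close> in the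
      clique and differs from \<open>s\<close> because it lies in \<open>K\<close>; this covers
      \<open>v = w\<close> as well.\<close>
    then show ?thesis using K_out[of v] clique_nbhd[OF cl] s SK by blast
  qed
  have "{s, w} \<in> E" using w(1) by (simp add: nbhd_def insert_commute)
  then show ?thesis using total_transitive_partition_of_edge[OF sg _ out] by blast
qed

theorem theorem1:
  fixes V S K :: "'a set" and E :: "'a set set"
  assumes "simple_graph V E"
    and "no_isolated V E"
    and "split_partition V E S K"
    and "clique_number V E = card K"
    and "S = {} \<longrightarrow> 4 \<le> card K"
  shows "total_transitivity V E = 1 \<longleftrightarrow>
      ((\<forall>s\<in>S. deg E s = 1) \<and> card {v\<in>K. nbhd E v \<inter> S = {}} \<le> 1) \<or>
      ((\<forall>s\<in>S. deg E s \<ge> 2 \<longrightarrow> (\<forall>v\<in>nbhd E s. support_vertex E v)) \<and>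
        card {v\<in>K. nbhd E v \<inter> S = {}} \<le> 1)"
    (is "_ \<longleftrightarrow> ?a \<or> ?b")
proof -
  have "V \<noteq> {}"
    using assms(3,5) by (auto simp: split_partition_def)
  note tr = total_transitivity_eq_1_iff[OF assms(1,2) this]
  have "?a \<Longrightarrow> ?b" by auto
  moreover have "total_transitivity V E = 1" if ?b
    unfolding tr using split_order_le_1[OF assms(1,3)] that by blast
  moreover have ?b if t: "total_transitivity V E = 1"
  proof (rule ccontr)
    assume "\<not> ?b"
    have "\<exists>P. total_transitive_partition V E 2 P"
    \<comment> \<open>The case distinction tells which half of (b) fails: the support condition or
      the bound on vertices of \<open>K\<close> without neighbours in \<open>S\<close>.\<close>
    proof (cases "card {v\<in>K. nbhd E v \<inter> S = {}} \<le> 1")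
      case True
      with \<open>\<not> ?b\<close> show ?thesis
        using split_order_2_of_non_support[OF assms(1-4)] by blast
    next
      case False
      then have "2 \<le> card {v\<in>K. nbhd E v \<inter> S = {}}" by simp
      then show ?thesis
        by (rule obtain_two_elements)
          (use split_order_2_of_two_inner[OF assms(1-3,5)] in blast)
    qed
    with t show False unfolding tr by fastforce
  qed
  ultimately show ?thesis by blast
qed

end
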